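(* There is an absolute constant $b_{\mathrm{LD}}>0$ such that the following holds. Let $d\in\mathbb{N}$, $\sigma>0$, and let $X_1,\dots,X_n$, $Y_1,\dots,Y_n$, $\pi^\star$ be generated according to Model LD+S (described in the context) with parameters $\|\cdot\|$, $R_d$, $\gamma$, $\beta$, $K_{\mathcal Q}$. Then for all $n\ge 2$, $$\mathbb{E}\left[d_H(\hat\pi_{\mathrm{LSS}},\pi^\star)\right]\ \le\ (3K^d n^2\sigma^d)\wedge n,\qquad\text{where } K=b_{\mathrm{LD}}\,K_{\mathcal Q}^2\,e^{2\beta}.$$
   Context: Model LD+S. The observations are $X_1,\dots,X_n$ and $Y_i=X_{\pi^\star(i)}+Z_i$, $i\in[n]$, where $X_1,\dots,X_n$ are i.i.d. in $\mathbb{R}^d$, $Z_1,\dots,Z_n$ are i.i.d. in $\mathbb{R}^d$, $\pi^\star$ is uniform on the symmetric group $S_n$, and the $X$'s, the $Z$'s and $\pi^\star$ are mutually independent. Assume in addition: (a) $X_i\sim\mathcal P$, where (i) $\mathcal P(\{x:\|x\|<R_d\})\ge\gamma$ for some norm $\|\cdot\|$ on $\mathbb{R}^d$ and some $R_d,\gamma>0$; (ii) $\mathcal P$ has a density $f_{\mathcal P}$ with respect to Lebesgue measure with $\operatorname{ess\,sup}_{\|x\|<R_d}f_{\mathcal P}(x)\,/\,\operatorname{ess\,inf}_{\|x\|<R_d}f_{\mathcal P}(x)\le e^{\beta d}$ for some constant $\beta\ge\log 2$. (b) $Z_i=\sigma\tilde Z_i$ with $\sigma>0$ and $\tilde Z_i\sim\mathcal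 Q$ i.i.d., where $\sup_{\|v\|<R_d}\|\mathcal Q(v)\otimes\mathcal Q(-v)-\mathcal Q\otimes\mathcal Q\|_{TV}\le 1-e^{-\beta d}$; here $\mathcal Q(v)$ is the law of $\tilde Z_1+v$, $\otimes$ is the product measure, $\|\cdot\|_{TV}$ is total variation distance (in $[0,1]$), and $\|\cdot\|,R_d,\beta$ are as in (a). (c) $\|f_{\mathcal P}\|_\infty\le e^{\beta d}$ for the same $\beta$. (d) $\tilde Z_i$ is centered and $\|\tilde Z_i\|_{\psi_2}\le K_{\mathcal Q}$, where for a real random variable $\|U\|_{\psi_2}=\inf\{L>0:\mathbb{E}[\exp(U^2/L^2)]\le 2\}$ and for a random vector $\|V\|_{\psi_2}=\sup_{\|v\|_2=1}\|\langle V,v\rangle\|_{\psi_2}$. The Hamming distance is $d_H(\hat\pi,\pi^\star)=\sum_{j=1}^n\mathbf 1[\hat\pi(j)\ne\pi^\star(j)]$. The least sum of squares estimator is $$\hat\pi_{\mathrm{LSS}}\in\arg\min_{\pi\in S_n}\sum_{j=1}^n\|X_{\pi(j)}-Y_j\|_2^2=\arg\max_{\pi\in S_n}\sum_{j=1}^n\langle X_{\pi(j)},Y_j\rangle .$$ We write $a\wedge b=\min(a,b)$.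
   Formalization: Adds the normalisation K_Q e^β ≥ 1; without it the bound fails: d=1, n=2, P uniform on [-1/2,1/2], Q=N(0,c²), σ=1/c, R_d and γ of order c, K_Q=c√(8/3), c→0 gives fixed risk but a bound of order c. *)

theory Defs
  imports "HOL-Probability.Probability"
begin

text \<open>
  The dimension is quantified inside the statement (the constant must not depend on it), so
  points of \<open>\<real>\<^sup>d\<close> are the functions in \<open>{..<d} \<rightarrow>\<^sub>E UNIV\<close>. The product measure below carries both
  the Borel \<open>\<sigma>\<close>-algebra and Lebesgue measure. Samples and permutations are indexed by \<open>{..<n}\<close>.
\<close>

abbreviation Rd :: "nat \<Rightarrow> (nat \<Rightarrow> real) measure" where
  "Rd d \<equiv> PiM {..<d} (\<lambda>_. lborel)"

definition vzero :: "nat \<Rightarrow> nat \<Rightarrow> real" where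
  "vzero d = (\<lambda>i\<in>{..<d}. 0)"

definition vadd :: "nat \<Rightarrow> (nat \<Rightarrow> real) \<Rightarrow> (nat \<Rightarrow> real) \<Rightarrow> nat \<Rightarrow> real" where
  "vadd d x y = (\<lambda>i\<in>{..<d}. x i + y i)"

definition vscale :: "nat \<Rightarrow> real \<Rightarrow> (nat \<Rightarrow> real) \<Rightarrow> nat \<Rightarrow> real" where
  "vscale d c x = (\<lambda>i\<in>{..<d}. c * x i)"

definition vinner :: "nat \<Rightarrow> (nat \<Rightarrow> real) \<Rightarrow> (nat \<Rightarrow> real) \<Rightarrow> real" where
  "vinner d x y = (\<Sum>i<d. x i * y i)"

definition is_norm :: "nat \<Rightarrow> ((nat \<Rightarrow> real) \<Rightarrow> real) \<Rightarrow> bool" where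
  "is_norm d N \<longleftrightarrow>
     (\<forall>x\<in>space (Rd d). 0 \<le> N x \<and> (N x = 0 \<longleftrightarrow> x = vzero d)) \<and>
     (\<forall>x\<in>space (Rd d). \<forall>c. N (vscale d c x) = \<bar>c\<bar> * N x) \<and>
     (\<forall>x\<in>space (Rd d). \<forall>y\<in>space (Rd d). N (vadd d x y) \<le> N x + N y)"

definition norm_ball :: "nat \<Rightarrow> ((nat \<Rightarrow> real) \<Rightarrow> real) \<Rightarrow> real \<Rightarrow> (nat \<Rightarrow> real) set" where
  "norm_ball d N R = {x \<in> space (Rd d). N x < R}"

definition essinf :: "'a measure \<Rightarrow> ('a \<Rightarrow> ereal) \<Rightarrow> ereal" where
  "essinf M f = Sup {c. AE x in M. c \<le> f x}"

definition tv_dist :: "'a measure \<Rightarrow> 'a measure \<Rightarrow> real" where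
  "tv_dist M N = (SUP A\<in>sets M. \<bar>measure M A - measure N A\<bar>)"

definition shift_law :: "nat \<Rightarrow> (nat \<Rightarrow> real) measure \<Rightarrow> (nat \<Rightarrow> real) \<Rightarrow> (nat \<Rightarrow> real) measure" where
  "shift_law d Q v = distr Q (Rd d) (\<lambda>z. vadd d z v)"

text \<open>
  Values are in \<open>ennreal\<close>, and the expectation is the nonnegative integral, so that a variable
  that is not sub-Gaussian has norm \<open>\<infinity>\<close>.
\<close>

definition psi2_norm :: "'a measure \<Rightarrow> ('a \<Rightarrow> real) \<Rightarrow> ennreal" where
  "psi2_norm M U =
     Inf {ennreal L | L. 0 < L \<and> (\<integral>\<^sup>+ w. ennreal (exp ((U w)\<^sup>2 / L\<^sup>2)) \<partial>M) \<le> 2}"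

definition psi2_vec_norm :: "nat \<Rightarrow> (nat \<Rightarrow> real) measure \<Rightarrow> ennreal" where
  "psi2_vec_norm d Q =
     (SUP v\<in>{v \<in> space (Rd d). L2_set v {..<d} = 1}. psi2_norm Q (\<lambda>z. vinner d z v))"

text \<open>
  Conditions (a)--(d) on the law \<open>P\<close> of the \<open>X\<^sub>i\<close> and the law \<open>Q\<close> of the unscaled noise.
  In the quotient, the denominator may be \<open>0\<close>; then the numerator is positive by the mass
  condition, and the \<open>ereal\<close> quotient is \<open>\<infinity>\<close>, as it should be.
\<close>

definition LDS_assumptions ::
    "nat \<Rightarrow> ((nat \<Rightarrow> real) \<Rightarrow> real) \<Rightarrow> real \<Rightarrow> real \<Rightarrow> real \<Rightarrow> real \<Rightarrow>
     (nat \<Rightarrow> real) measure \<Rightarrow> (nat \<Rightarrow> real) measure \<Rightarrow> bool" where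
  "LDS_assumptions d N R \<gamma> \<beta> KQ P Q \<longleftrightarrow>
     is_norm d N \<and> 0 < R \<and> 0 < \<gamma> \<and> ln 2 \<le> \<beta> \<and>
     prob_space P \<and>
     measure P (norm_ball d N R) \<ge> \<gamma> \<and>
     (\<exists>f\<in>borel_measurable (Rd d).
        (\<forall>x. 0 \<le> f x) \<and>
        P = density (Rd d) (\<lambda>x. ennreal (f x)) \<and>
        esssup (restrict_space (Rd d) (norm_ball d N R)) (\<lambda>x. ereal (f x))
          / essinf (restrict_space (Rd d) (norm_ball d N R)) (\<lambda>x. ereal (f x))
          \<le> ereal (exp (\<beta> * real d)) \<and>
        esssup (Rd d) (\<lambda>x. ereal (f x)) \<le> ereal (exp (\<beta> * real d))) \<and>
     prob_space Q \<and> sets Q = sets (Rd d) \<and>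
     (\<forall>v\<in>norm_ball d N R.
        tv_dist (shift_law d Q v \<Otimes>\<^sub>M shift_law d Q (vscale d (- 1) v)) (Q \<Otimes>\<^sub>M Q)
          \<le> 1 - exp (- \<beta> * real d)) \<and>
     (\<forall>i<d. integrable Q (\<lambda>z. z i) \<and> (\<integral>z. z i \<partial>Q) = 0) \<and>
     psi2_vec_norm d Q \<le> ennreal KQ"

text \<open>
  The joint law of \<open>((X\<^sub>i)\<^sub>i, (Z\<^sub>i / \<sigma>)\<^sub>i, \<pi>\<^sup>\<star>)\<close>: independence and identical distribution are expressed
  by the product measure. Working with this law instead of random variables on an arbitrary
  probability space keeps the absolute constant of the theorem independent of a sample space type.
\<close>

definition LDS_law ::
    "nat \<Rightarrow> (nat \<Rightarrow> real) measure \<Rightarrow> (nat \<Rightarrow> real) measure \<Rightarrow>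
     ((nat \<Rightarrow> nat \<Rightarrow> real) \<times> (nat \<Rightarrow> nat \<Rightarrow> real) \<times> (nat \<Rightarrow> nat)) measure" where
  "LDS_law n P Q =
     PiM {..<n} (\<lambda>_. P) \<Otimes>\<^sub>M PiM {..<n} (\<lambda>_. Q) \<Otimes>\<^sub>M uniform_count_measure {\<pi>. \<pi> permutes {..<n}}"

definition LDS_obs ::
    "nat \<Rightarrow> nat \<Rightarrow> real \<Rightarrow> (nat \<Rightarrow> nat \<Rightarrow> real) \<Rightarrow> (nat \<Rightarrow> nat \<Rightarrow> real) \<Rightarrow> (nat \<Rightarrow> nat) \<Rightarrow> nat \<Rightarrow> nat \<Rightarrow> real" where
  "LDS_obs d n \<sigma> x z \<pi> = (\<lambda>i\<in>{..<n}. vadd d (x (\<pi> i)) (vscale d \<sigma> (z i)))"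

text \<open>
  A least sum of squares estimator is any measurable function of the data that always takes a
  value in the argmin, ties being broken arbitrarily.
\<close>

definition is_LSS ::
    "nat \<Rightarrow> nat \<Rightarrow> ((nat \<Rightarrow> nat \<Rightarrow> real) \<times> (nat \<Rightarrow> nat \<Rightarrow> real) \<Rightarrow> nat \<Rightarrow> nat) \<Rightarrow> bool" where
  "is_LSS d n est \<longleftrightarrow>
     est \<in> measurable (PiM {..<n} (\<lambda>_. Rd d) \<Otimes>\<^sub>M PiM {..<n} (\<lambda>_. Rd d))
             (count_space {\<pi>. \<pi> permutes {..<n}}) \<and>
     (\<forall>x\<in>space (PiM {..<n} (\<lambda>_. Rd d)). \<forall>y\<in>space (PiM {..<n} (\<lambda>_. Rd d)).
        is_arg_min (\<lambda>\<pi>. \<Sum>j<n. (L2_set (\<lambda>i. x (\<pi> j) i - y j i) {..<d})\<^sup>2)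
          (\<lambda>\<pi>. \<pi> permutes {..<n}) (est (x, y)))"

definition hamming :: "nat \<Rightarrow> (nat \<Rightarrow> nat) \<Rightarrow> (nat \<Rightarrow> nat) \<Rightarrow> nat" where
  "hamming n \<pi> \<pi>' = (\<Sum>j<n. of_bool (\<pi> j \<noteq> \<pi>' j))"

definition LSS_risk ::
    "nat \<Rightarrow> nat \<Rightarrow> real \<Rightarrow> (nat \<Rightarrow> real) measure \<Rightarrow> (nat \<Rightarrow> real) measure \<Rightarrow>
     ((nat \<Rightarrow> nat \<Rightarrow> real) \<times> (nat \<Rightarrow> nat \<Rightarrow> real) \<Rightarrow> nat \<Rightarrow> nat) \<Rightarrow> real" where
  "LSS_risk d n \<sigma> P Q est =
     (\<integral>(x, z, \<pi>). real (hamming n (est (x, LDS_obs d n \<sigma> x z \<pi>)) \<pi>) \<partial>LDS_law n P Q)"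

text \<open>
  The bound with \<open>K = b K\<^sub>Q\<^sup>2 exp(2\<beta>)\<close> needs a normalisation of \<open>K\<^sub>Q\<close>: replacing \<open>Q\<close> by the law of
  \<open>c\<close> times the noise, and \<open>R\<close>, \<open>K\<^sub>Q\<close>, \<open>\<sigma>\<close> by \<open>c R\<close>, \<open>c K\<^sub>Q\<close>, \<open>\<sigma> / c\<close>, leaves the observations unchanged
  and, for \<open>c \<le> 1\<close>, keeps the conditions valid for some smaller \<open>\<gamma>\<close>, but the bound scales like
  \<open>c\<^sup>d\<close>. Some lower bound on \<open>K\<^sub>Q\<close> is therefore implicit, such as the usual
  \<open>K\<^sub>Q \<ge> 1\<close>. The weaker \<open>K\<^sub>Q exp(\<beta>) \<ge> 1\<close> is what makes \<open>K\<^sub>Q exp(\<beta>)\<close> at most its square.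
  It restricts no pair of laws, since \<open>K\<^sub>Q\<close> is only an upper bound and may be increased.
\<close>

end

theory Submission
  imports Defs "HOL-Combinatorics.Cycles"
begin

text \<open>
  If the estimator \<open>p\<close> and the truth \<open>\<pi>\<close> differ at \<open>j\<close>, let \<open>l\<^sub>0, \<dots>, l\<^bsub>t-1\<^esub>\<close> be the cycle of \<open>j\<close> under
  \<open>\<pi>\<close>-inverse after \<open>p\<close>. Replacing \<open>p\<close> by \<open>\<pi>\<close> on this cycle cannot decrease the cost. So, with
  \<open>\<delta>\<^sub>k\<close> the difference of the \<open>X\<close>-points matched by \<open>\<pi>\<close> to the successor of \<open>l\<^sub>k\<close> and to \<open>l\<^sub>k\<close>, the
  Hamming distance is at most the number of lists of at least two distinct indices for which
  \<open>\<Sum>\<^sub>k \<bar>\<delta>\<^sub>k\<bar>\<^sup>2\<close> is at most \<open>2 \<sigma>\<close> times the sum of the inner products of \<open>\<delta>\<^sub>k\<close> with the noise at \<open>l\<^sub>k\<close>.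
  Given \<open>X\<close>, the Chernoff bound gives such a list probability at most \<open>exp (- a \<Sum>\<^sub>k \<bar>\<delta>\<^sub>k\<bar>\<^sup>2)\<close> with
  \<open>a = 1 / (64 K\<^sup>2 \<sigma>\<^sup>2)\<close>. Dropping the edge that closes the cycle leaves a path, and
  integrating out its vertices one by one against a density bounded by \<open>exp (\<beta> d)\<close> costs a factor
  \<open>q = (16 K \<sigma> exp \<beta>)\<^sup>d\<close> per edge. There are at most \<open>n\<^sup>t\<close> lists of length \<open>t\<close>; the
  sum of \<open>n\<^sup>t q\<^bsup>t-1\<^esup>\<close> over \<open>t \<ge> 2\<close> is at most \<open>2 n\<^sup>2 q\<close> if \<open>n q \<le> 1/2\<close>, and otherwise \<open>n \<le> 2 n\<^sup>2 q\<close>.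
\<close>

section \<open>Exchange along a cycle of an optimal assignment\<close>

text \<open>With \<open>\<rho>\<close> equal to \<open>inv q\<close> after \<open>p\<close>, one has
  \<open>p i = q (\<rho> i)\<close>, so on an orbit of \<open>\<rho>\<close> the assignment
  \<open>p\<close> is \<open>q\<close> shifted by one place. Switching from \<open>p\<close> to
  \<open>q\<close> on the orbit of \<open>j\<close> gives a competitor of \<open>p\<close>; outside
  the orbit the costs cancel.\<close>

lemma optimal_assignment_cycle:
  fixes c :: "'a \<Rightarrow> 'a \<Rightarrow> real"
  assumes "finite A" and p: "p permutes A" and q: "q permutes A"
    and opt: "\<And>r. r permutes A \<Longrightarrow> (\<Sum>j\<in>A. c (p j) j) \<le> (\<Sum>j\<in>A. c (r j) j)"
    and j: "p j \<noteq> q j"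
  obtains l where "distinct l" "set l \<subseteq> A" "2 \<le> length l" "hd l = j"
    "(\<Sum>k<length l. c (q (l ! (Suc k mod length l))) (l ! k)) \<le> (\<Sum>k<length l. c (q (l ! k)) (l ! k))"
proof -
  define \<rho> where "\<rho> = inv q \<circ> p"
  have \<rho>: "\<rho> permutes A"
    unfolding \<rho>_def using p q by (intro permutes_compose permutes_inv)
  have q\<rho>: "q (\<rho> i) = p i" for i
    using q by (simp add: \<rho>_def permutes_inverses)
  have perm: "permutation \<rho>"
    using \<rho> \<open>finite A\<close> by (auto simp: permutation_permutes)
  have "\<rho> j \<noteq> j"
    using j q\<rho>[of j] by metis
  then have "j \<in> A"
    using \<rho> by (meson permutes_not_in)
  define t where "t = least_power \<rho> j"
  define l where "l = support \<rho> j"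
  have len: "length l = t" by (simp add: l_def t_def)
  have "1 < t"
    unfolding t_def using least_power_gt_one[OF perm \<open>\<rho> j \<noteq> j\<close>] by simp
  have \<rho>t: "(\<rho> ^^ t) j = j"
    unfolding t_def by (rule least_power_of_permutation(1)[OF perm])
  have nth: "l ! k = (\<rho> ^^ k) j" if "k < t" for k
    using that by (simp add: l_def t_def)
  have dist: "distinct l"
    unfolding l_def by (rule cycle_of_permutation[OF perm])
  have "(\<rho> ^^ k) j \<in> A" for k
    using permutes_in_image[OF permutes_funpow[OF \<rho>]] \<open>j \<in> A\<close> by auto
  then have sub: "set l \<subseteq> A"
    by (auto simp: l_def)
  have step: "\<rho> (l ! k) = l ! (Suc k mod t)" if "k < t" for k
  proof (cases "Suc k = t")
    case True
    then have "\<rho> (l ! k) = (\<rho> ^^ t) j" using that by (auto simp: nth)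
    then show ?thesis using True \<rho>t nth[of 0] by simp
  qed (use that in \<open>simp add: nth\<close>)
  have closed: "\<rho> i \<in> set l" if i: "i \<in> set l" for i
  proof -
    obtain k where "k < t" "i = l ! k" using i unfolding in_set_conv_nth len by blast
    then show ?thesis using step[of k] len \<open>1 < t\<close> by simp
  qed
  then have img: "\<rho> ` set l = set l"
    using permutes_inj_on[OF \<rho>] by (intro endo_inj_surj) auto
  define r where "r = (\<lambda>i. if i \<in> set l then q i else p i)"
  \<comment> \<open>\<open>r\<close> is \<open>q\<close> after the map that freezes the orbit and
    acts as \<open>\<rho>\<close> elsewhere. This map is injective: \<open>\<rho>\<close> sends the
    orbit onto itself, so it sends no outside point into it.\<close>
  have "(\<lambda>i. if i \<in> set l then i else \<rho> i) permutes A"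
  proof (rule inj_imp_permutes[OF _ \<open>finite A\<close>])
    show "inj_on (\<lambda>i. if i \<in> set l then i else \<rho> i) A"
      unfolding inj_on_def using img permutes_inj[OF \<rho>, THEN injD] by (smt (verit) image_iff)
  qed (use sub \<rho> in \<open>auto simp: permutes_in_image permutes_not_in\<close>)
  then have "q \<circ> (\<lambda>i. if i \<in> set l then i else \<rho> i) permutes A"
    by (intro permutes_compose q)
  also have "q \<circ> (\<lambda>i. if i \<in> set l then i else \<rho> i) = r"
    by (auto simp: r_def q\<rho>)
  finally have "(\<Sum>j\<in>A. c (p j) j) \<le> (\<Sum>j\<in>A. c (r j) j)"
    by (rule opt)
  moreover have "(\<Sum>j\<in>A. f j) = (\<Sum>j\<in>A - set l. f j) + (\<Sum>j\<in>set l. f j)" for f :: "'a \<Rightarrow> real"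
    using sub \<open>finite A\<close> by (rule sum.subset_diff)
  ultimately have le: "(\<Sum>j\<in>set l. c (p j) j) \<le> (\<Sum>j\<in>set l. c (q j) j)"
    by (simp add: r_def)
  have reindex: "(\<Sum>j\<in>set l. f j) = (\<Sum>k<length l. f (l ! k))" for f :: "'a \<Rightarrow> real"
    using bij_betw_nth[OF dist refl refl] by (simp add: sum.reindex_bij_betw[symmetric])
  have "(\<Sum>k<length l. c (q (l ! (Suc k mod length l))) (l ! k)) \<le> (\<Sum>k<length l. c (q (l ! k)) (l ! k))"
    using le unfolding reindex by (simp add: step[symmetric] q\<rho> len)
  moreover have "hd l = j" using \<open>1 < t\<close> nth[of 0] len by (subst hd_conv_nth) auto
  ultimately show ?thesis
    using that dist sub len \<open>1 < t\<close> by simp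
qed

section \<open>Moment generating function of a sub-Gaussian variable\<close>

text \<open>For a centered variable the linear term vanishes in expectation, and the squared
  exponential is what a psi2 bound controls. On [-1, 1] the polynomial
  \<open>1 + x + x\<^sup>2\<close> lies between the two sides.\<close>

lemma exp_le_add_exp_square: "exp x \<le> x + exp (x\<^sup>2)" for x :: real
proof -
  have sq: "1 + x\<^sup>2 \<le> exp (x\<^sup>2)" by (rule exp_ge_add_one_self)
  consider "x < -1" | "-1 \<le> x" "x \<le> 1" | "1 < x" by linarith
  then show ?thesis
  proof cases
    case 1
    then have "0 < (- 1 - x) * (- x)" by (intro mult_pos_pos) auto
    then have "0 < x + x\<^sup>2" by (simp add: algebra_simps power2_eq_square)
    moreover have "exp x \<le> 1" using 1 by simp
    ultimately show ?thesis using sq by linarith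
  next
    case 2
    have "exp x \<le> 1 + x + x\<^sup>2"
    proof (cases "0 \<le> x")
      case True
      then show ?thesis using exp_bound 2 by auto
    next
      case False
      \<comment> \<open>The product is 1 - x^3. Replacing its first factor by the larger
        \<open>exp (- x)\<close> and multiplying by \<open>exp x\<close> gives the bound.\<close>
      have "(1 - x) * (1 + x + x\<^sup>2) \<ge> 1"
        using False mult_nonneg_nonneg[of "x\<^sup>2" "-x"] by (simp add: algebra_simps power2_eq_square)
      moreover have "1 - x \<le> exp (- x)" using exp_ge_add_one_self[of "-x"] by simp
      moreover have "0 \<le> 1 + x + x\<^sup>2" using 2 by simp
      ultimately have "1 \<le> exp (- x) * (1 + x + x\<^sup>2)"
        by (meson mult_right_mono order_trans)
      then have "exp x * 1 \<le> exp x * (exp (- x) * (1 + x + x\<^sup>2))"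
        by (intro mult_left_mono) auto
      then show ?thesis by (simp add: mult.assoc[symmetric] exp_minus)
    qed
    then show ?thesis using sq by linarith
  next
    case 3
    then have "x \<le> x\<^sup>2" by (simp add: power2_eq_square)
    then have "exp x \<le> exp (x\<^sup>2)" by simp
    then show ?thesis using 3 by linarith
  qed
qed

text \<open>There are two regimes, each with an explicit integrable majorant \<open>g\<close>. If
  \<open>(s * L)\<^sup>2\<close> is at most 1, the preceding inequality isolates the linear term and
  convexity of exp bounds the rest by the psi2 moment. Otherwise the linear term is absorbed by the
  inequality between a product and two squares, and the largeness of \<open>(s * L)\<^sup>2\<close>
  pays for the constant.\<close>

lemma (in prob_space) subgaussian_mgf_le:
  assumes [measurable]: "U \<in> borel_measurable M" and int: "integrable M U" and "expectation U = 0"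
    and L: "0 < L" and psi: "(\<integral>\<^sup>+ w. ennreal (exp ((U w)\<^sup>2 / L\<^sup>2)) \<partial>M) \<le> 2"
  shows "(\<integral>\<^sup>+ w. ennreal (exp (s * U w)) \<partial>M) \<le> ennreal (exp (s\<^sup>2 * L\<^sup>2))"
proof -
  define E where "E = (\<lambda>w. exp ((U w)\<^sup>2 / L\<^sup>2))"
  have [measurable]: "E \<in> borel_measurable M" by (simp add: E_def)
  have E: "integrable M E"
    using psi by (intro integrableI_bounded) (auto simp: E_def intro: order.strict_trans1 simp del: ennreal_numeral)
  have E2: "expectation E \<le> 2"
    using psi nn_integral_eq_integral[OF E] by (simp add: E_def del: ennreal_numeral flip: ennreal_numeral)
  have psq: "(s * L)\<^sup>2 * ((U w)\<^sup>2 / L\<^sup>2) = (s * U w)\<^sup>2" for w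
    using L by (simp add: field_simps)
  obtain g where g: "integrable M g" "\<And>w. exp (s * U w) \<le> g w" "expectation g \<le> exp (s\<^sup>2 * L\<^sup>2)"
  proof (cases "(s * L)\<^sup>2 \<le> 1")
    case True
    let ?g = "\<lambda>w. s * U w + (1 + (s * L)\<^sup>2 * (E w - 1))"
    show ?thesis
    proof
      show "integrable M ?g" using int E by simp
      show "exp (s * U w) \<le> ?g w" for w
      proof -
        \<comment> \<open>\<open>(s * U w)\<^sup>2\<close> is the convex combination of 0 and
          \<open>(U w)\<^sup>2 / L\<^sup>2\<close> with weight \<open>(s * L)\<^sup>2\<close> on the
          latter.\<close>
        have "exp ((1 - (s * L)\<^sup>2) *\<^sub>R 0 + (s * L)\<^sup>2 *\<^sub>R ((U w)\<^sup>2 / L\<^sup>2))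
          \<le> (1 - (s * L)\<^sup>2) * exp 0 + (s * L)\<^sup>2 * exp ((U w)\<^sup>2 / L\<^sup>2)"
          by (rule convex_onD[OF exp_convex]) (use True in auto)
        then have "exp ((s * U w)\<^sup>2) \<le> 1 + (s * L)\<^sup>2 * (E w - 1)"
          unfolding E_def by (simp only: psq real_scaleR_def) (simp add: algebra_simps)
        then show ?thesis using exp_le_add_exp_square[of "s * U w"] by linarith
      qed
      have "expectation ?g = 1 + (s * L)\<^sup>2 * (expectation E - 1)"
        using int E \<open>expectation U = 0\<close> by (simp add: prob_space)
      also have "\<dots> \<le> 1 + (s * L)\<^sup>2 * 1"
        using E2 by (intro add_left_mono mult_left_mono) auto
      also have "\<dots> \<le> exp (s\<^sup>2 * L\<^sup>2)"
        using exp_ge_add_one_self[of "s\<^sup>2 * L\<^sup>2"] by (simp add: power_mult_distrib)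
      finally show "expectation ?g \<le> exp (s\<^sup>2 * L\<^sup>2)" .
    qed
  next
    case False
    let ?g = "\<lambda>w. exp ((s * L)\<^sup>2 / 2) * ((1 + E w) / 2)"
    show ?thesis
    proof
      show "integrable M ?g" using E by simp
      show "exp (s * U w) \<le> ?g w" for w
      proof -
        have "2 * ((s * L) * (U w / L)) \<le> (s * L)\<^sup>2 + (U w / L)\<^sup>2"
          using sum_squares_bound[of "s * L" "U w / L"] by (simp only: mult.assoc)
        then have "s * U w \<le> (s * L)\<^sup>2 / 2 + (U w)\<^sup>2 / L\<^sup>2 / 2"
          using L by (simp add: power_divide)
        then have "exp (s * U w) \<le> exp ((s * L)\<^sup>2 / 2) * exp ((U w)\<^sup>2 / L\<^sup>2 / 2)"
          by (simp add: exp_add[symmetric])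
        moreover have "exp (x / 2) \<le> (1 + exp x) / 2" for x :: real
          using sum_squares_bound[of 1 "exp (x / 2)"] by (simp add: exp_double[symmetric] field_simps)
        ultimately show ?thesis
          by (smt (verit) E_def exp_gt_zero mult_left_mono)
      qed
      have "expectation ?g = exp ((s * L)\<^sup>2 / 2) * ((1 + expectation E) / 2)"
        using E by (simp add: prob_space)
      also have "\<dots> \<le> exp ((s * L)\<^sup>2 / 2) * exp ((s * L)\<^sup>2 / 2)"
      proof (intro mult_left_mono)
        \<comment> \<open>The left side is at most 3/2, and the right side exceeds 3/2 because
          \<open>(s * L)\<^sup>2\<close> exceeds 1.\<close>
        have "(1 + expectation E) / 2 \<le> 1 + (s * L)\<^sup>2 / 2"
          using E2 False by (simp add: field_simps)
        also have "\<dots> \<le> exp ((s * L)\<^sup>2 / 2)" by (rule exp_ge_add_one_self)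
        finally show "(1 + expectation E) / 2 \<le> exp ((s * L)\<^sup>2 / 2)" .
      qed simp
      also have "\<dots> = exp (s\<^sup>2 * L\<^sup>2)"
        by (simp add: exp_add[symmetric] power_mult_distrib)
      finally show "expectation ?g \<le> exp (s\<^sup>2 * L\<^sup>2)" .
    qed
  qed
  have "0 \<le> g w" for w using g(2)[of w] by (smt (verit) exp_gt_zero)
  have "(\<integral>\<^sup>+ w. ennreal (exp (s * U w)) \<partial>M) \<le> (\<integral>\<^sup>+ w. ennreal (g w) \<partial>M)"
    by (intro nn_integral_mono ennreal_leI g)
  also have "\<dots> = ennreal (expectation g)"
    using g(1) \<open>\<And>w. 0 \<le> g w\<close> by (intro nn_integral_eq_integral) auto
  also have "\<dots> \<le> ennreal (exp (s\<^sup>2 * L\<^sup>2))"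
    using g(3) by (rule ennreal_leI)
  finally show ?thesis .
qed

section \<open>Integration of Gaussians, of products over distinct indices and along paths\<close>

lemma nn_integral_gaussian:
  assumes "0 < a"
  shows "(\<integral>\<^sup>+ x. ennreal (exp (- a * (x - m)\<^sup>2)) \<partial>lborel) = ennreal (sqrt (pi / a))"
proof -
  \<comment> \<open>With this standard deviation the normal density is the integrand divided by
    \<open>sqrt (pi / a)\<close>.\<close>
  define s where "s = sqrt (1 / (2 * a))"
  have s: "s\<^sup>2 = 1 / (2 * a)" using assms by (simp add: s_def)
  have "0 < s" using assms by (simp add: s_def)
  have "exp (- a * (x - m)\<^sup>2) = sqrt (pi / a) * normal_density m s x" for x
    using assms by (simp add: normal_density_def s)
  then have "(\<integral>\<^sup>+ x. ennreal (exp (- a * (x - m)\<^sup>2)) \<partial>lborel)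
      = (\<integral>\<^sup>+ x. ennreal (sqrt (pi / a)) * ennreal (normal_density m s x) \<partial>lborel)"
    using assms by (simp add: ennreal_mult)
  also have "\<dots> = ennreal (sqrt (pi / a)) * (\<integral>\<^sup>+ x. ennreal (normal_density m s x) \<partial>lborel)"
    by (rule nn_integral_cmult) simp
  also have "(\<integral>\<^sup>+ x. ennreal (normal_density m s x) \<partial>lborel) = 1"
    using \<open>0 < s\<close> by (subst nn_integral_eq_integral) auto
  finally show ?thesis by simp
qed

text \<open>Distinct entries are independent coordinates. The product over list positions is
  rewritten as one over all of \<open>I\<close>, with factor 1 at the indices outside the list;
  these integrate to 1 because \<open>M\<close> is a probability measure.\<close>

lemma (in prob_space) nn_integral_PiM_distinct:
  assumes "finite I" "distinct l" "set l \<subseteq> I"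
    and meas: "\<And>k. k < length l \<Longrightarrow> \<phi> k \<in> borel_measurable M"
  shows "(\<integral>\<^sup>+ z. (\<Prod>k<length l. \<phi> k (z (l ! k))) \<partial>PiM I (\<lambda>_. M)) = (\<Prod>k<length l. \<integral>\<^sup>+ w. \<phi> k w \<partial>M)"
proof -
  note emeasure_space = emeasure_space_1
  interpret product_prob_space "\<lambda>_. M" ..
  define idx where "idx = the_inv_into {..<length l} ((!) l)"
  have bij: "bij_betw ((!) l) {..<length l} (set l)"
    using \<open>distinct l\<close> by (rule bij_betw_nth) auto
  then have idx: "idx (l ! k) = k" if "k < length l" for k
    using that unfolding idx_def by (intro the_inv_into_f_f) (auto simp: bij_betw_def)
  define G where "G = (\<lambda>j. if j \<in> set l then \<phi> (idx j) else (\<lambda>_. 1))"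
  have prod_eq: "(\<Prod>k<length l. F k) = (\<Prod>j\<in>I. if j \<in> set l then F (idx j) else 1)" for F :: "nat \<Rightarrow> ennreal"
  proof -
    have "(\<Prod>k<length l. F k) = (\<Prod>k<length l. F (idx (l ! k)))" by (simp add: idx)
    also have "\<dots> = (\<Prod>j\<in>set l. F (idx j))" by (rule prod.reindex_bij_betw[OF bij])
    also have "\<dots> = (\<Prod>j\<in>I. if j \<in> set l then F (idx j) else 1)"
      using assms by (intro prod.mono_neutral_cong_left) auto
    finally show ?thesis .
  qed
  have nth_idx: "l ! idx j = j" "idx j < length l" if "j \<in> set l" for j
    using that idx by (auto simp: in_set_conv_nth)
  have "(\<Prod>k<length l. \<phi> k (z (l ! k))) = (\<Prod>j\<in>I. G j (z j))" for z
    unfolding prod_eq by (intro prod.cong) (auto simp: G_def nth_idx)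
  then have "(\<integral>\<^sup>+ z. (\<Prod>k<length l. \<phi> k (z (l ! k))) \<partial>PiM I (\<lambda>_. M)) = (\<Prod>j\<in>I. integral\<^sup>N M (G j))"
    using assms nth_idx by (simp, subst product_nn_integral_prod) (auto simp: G_def)
  also have "\<dots> = (\<Prod>k<length l. \<integral>\<^sup>+ w. \<phi> k w \<partial>M)"
    unfolding prod_eq by (intro prod.cong) (auto simp: G_def emeasure_space)
  finally show ?thesis .
qed

text \<open>By induction on the list: the first vertex occurs in the first edge factor only, so
  integrating it out costs at most \<open>q\<close> whatever the second vertex is. A shorter path
  remains, on \<open>I\<close> without that vertex, so \<open>I\<close> must vary in the induction.
  On a closed cycle of at least three vertices the first one would occur in two edges.\<close>

lemma (in prob_space) nn_integral_PiM_path: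
  fixes I :: "'i set" and h :: "'a \<Rightarrow> 'a \<Rightarrow> ennreal"
  assumes "finite I" "distinct l" "set l \<subseteq> I" "l \<noteq> []"
    and h: "case_prod h \<in> borel_measurable (M \<Otimes>\<^sub>M M)"
    and le: "\<And>w. w \<in> space M \<Longrightarrow> (\<integral>\<^sup>+ y. h y w \<partial>M) \<le> q"
  shows "(\<integral>\<^sup>+ x. (\<Prod>k<length l - 1. h (x (l ! k)) (x (l ! Suc k))) \<partial>PiM I (\<lambda>_. M)) \<le> q ^ (length l - 1)"
  using assms(1-4)
proof (induction l arbitrary: I)
  case (Cons i l)
  interpret product_prob_space "\<lambda>_. M" ..
  show ?case
  proof (cases l)
    case Nil
    interpret PI: prob_space "PiM I (\<lambda>_. M)" by (intro prob_space_PiM) unfold_locales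
    show ?thesis using Nil by (simp add: PI.emeasure_space_1)
  next
    case (Cons j l')
    define J where "J = I - {i}"
    have J: "finite J" "i \<notin> J" "I = insert i J" "set l \<subseteq> J" "j \<in> J"
      using Cons Cons.prems by (auto simp: J_def)
    define G where "G = (\<lambda>x. \<Prod>k<length l - 1. h (x (l ! k)) (x (l ! Suc k)))"
    have h': "(\<lambda>x. h (f x) (g x)) \<in> borel_measurable N"
      if "f \<in> measurable N M" "g \<in> measurable N M" for f g and N :: "('i \<Rightarrow> 'a) measure"
      using measurable_compose[OF measurable_Pair[OF that] h] by simp
    have comp: "(\<lambda>x. x m) \<in> measurable (PiM K (\<lambda>_. M)) M" if "m \<in> K" for m and K :: "'i set"
      using that by (rule measurable_component_singleton)
    have Gm: "G \<in> borel_measurable (PiM K (\<lambda>_. M))" if "set l \<subseteq> K" for K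
      unfolding G_def 
      by (intro borel_measurable_prod_ennreal h' comp subsetD[OF that] nth_mem) simp_all
    have split: "(\<Prod>k<length (i # l) - 1. h (x ((i # l) ! k)) (x ((i # l) ! Suc k))) = h (x i) (x j) * G x" for x
      by (simp add: Cons G_def prod.lessThan_Suc_shift del: prod.lessThan_Suc)
    \<comment> \<open>The removed vertex is not an entry of \<open>l\<close>, so the remaining
      factors are constant under the inner integral.\<close>
    have upd: "G (x(i := y)) = G x" for x y
    proof -
      have "l ! k \<noteq> i" if "k < length l" for k using J nth_mem[OF that] by auto
      then show ?thesis unfolding G_def by (intro prod.cong) auto
    qed
    have "(\<integral>\<^sup>+ x. h (x i) (x j) * G x \<partial>PiM I (\<lambda>_. M))
        = (\<integral>\<^sup>+ x. (\<integral>\<^sup>+ y. h y (x j) * G x \<partial>M) \<partial>PiM J (\<lambda>_. M))"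
      unfolding J(3) using J
      by (subst product_nn_integral_insert)
        (auto simp: upd intro!: nn_integral_cong borel_measurable_times_ennreal h' comp Gm)
    also have "\<dots> \<le> (\<integral>\<^sup>+ x. q * G x \<partial>PiM J (\<lambda>_. M))"
    proof (intro nn_integral_mono)
      fix x assume "x \<in> space (PiM J (\<lambda>_. M))"
      then have xj: "x j \<in> space M" using \<open>j \<in> J\<close> by (auto simp: space_PiM)
      then have "(\<integral>\<^sup>+ y. h y (x j) * G x \<partial>M) = (\<integral>\<^sup>+ y. h y (x j) \<partial>M) * G x"
        using measurable_compose[OF measurable_Pair2'[OF xj] h] by (intro nn_integral_multc) (simp only: prod.case)
      also have "\<dots> \<le> q * G x" using le[OF xj] by (intro mult_right_mono) auto
      finally show "(\<integral>\<^sup>+ y. h y (x j) * G x \<partial>M) \<le> q * G x" .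
    qed
    also have "\<dots> = q * (\<integral>\<^sup>+ x. G x \<partial>PiM J (\<lambda>_. M))"
      using J by (intro nn_integral_cmult Gm) auto
    also have "\<dots> \<le> q * q ^ (length l - 1)"
      using Cons.IH[of J] J Cons Cons.prems by (intro mult_left_mono) (auto simp: G_def)
    also have "\<dots> = q ^ (length (i # l) - 1)" by (simp add: Cons)
    finally show ?thesis unfolding split .
  qed
qed simp

section \<open>Density bound and noise bound in dimension \<open>d\<close>\<close>

definition sqdist :: "nat \<Rightarrow> (nat \<Rightarrow> real) \<Rightarrow> (nat \<Rightarrow> real) \<Rightarrow> real" where
  "sqdist d x y = (\<Sum>i<d. (x i - y i)\<^sup>2)"

lemma sqdist_nonneg: "0 \<le> sqdist d x y"
  by (simp add: sqdist_def sum_nonneg)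

lemma sqdist_commute: "sqdist d x y = sqdist d y x"
  by (simp add: sqdist_def power2_commute)

lemma nn_integral_Rd_gaussian:
  assumes "0 < a"
  shows "(\<integral>\<^sup>+ x. ennreal (exp (- a * sqdist d x y)) \<partial>Rd d) = ennreal (sqrt (pi / a) ^ d)"
proof -
  interpret product_sigma_finite "\<lambda>_::nat. lborel :: real measure" ..
  have "ennreal (exp (- a * sqdist d x y)) = (\<Prod>i<d. ennreal (exp (- a * (x i - y i)\<^sup>2)))" for x
    by (simp add: sqdist_def sum_distrib_left exp_sum[symmetric] prod_ennreal sum_negf)
  then have "(\<integral>\<^sup>+ x. ennreal (exp (- a * sqdist d x y)) \<partial>Rd d)
      = (\<Prod>i<d. \<integral>\<^sup>+ x. ennreal (exp (- a * (x - y i)\<^sup>2)) \<partial>lborel)"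
    by (simp, subst product_nn_integral_prod) auto
  also have "\<dots> = ennreal (sqrt (pi / a) ^ d)"
    unfolding nn_integral_gaussian[OF assms] using assms by (simp add: ennreal_power)
  finally show ?thesis .
qed

text \<open>Condition (c) enters through this comparison: it trades the law of the
  \<open>X\<close>-points for Lebesgue measure at the cost of a factor \<open>B\<close>.\<close>

lemma nn_integral_density_le_esssup:
  fixes f :: "'a \<Rightarrow> real"
  assumes [measurable]: "f \<in> borel_measurable M" "g \<in> borel_measurable M"
    and le: "esssup M (\<lambda>x. ereal (f x)) \<le> ereal B"
  shows "(\<integral>\<^sup>+ x. g x \<partial>density M (\<lambda>x. ennreal (f x))) \<le> ennreal B * (\<integral>\<^sup>+ x. g x \<partial>M)"
proof -
  have "AE x in M. f x \<le> B"
    using esssup_AE[of "\<lambda>x. ereal (f x)" M]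
    by (rule eventually_mono) (use le order_trans in \<open>fastforce simp flip: ereal_less_eq(3)\<close>)
  then have "(\<integral>\<^sup>+ x. ennreal (f x) * g x \<partial>M) \<le> (\<integral>\<^sup>+ x. ennreal B * g x \<partial>M)"
    by (intro nn_integral_mono_AE) (auto elim!: eventually_mono intro: mult_right_mono ennreal_leI)
  then show ?thesis
    by (simp add: nn_integral_density nn_integral_cmult)
qed

text \<open>The infimum in the norm is not known to be attained. The strict inequality
  \<open>K < L\<close> yields an admissible scale below \<open>L\<close>, and the moment decreases
  as the scale grows.\<close>

lemma psi2_norm_leD:
  assumes "psi2_norm M U \<le> ennreal K" "0 < L" "K < L"
  shows "(\<integral>\<^sup>+ w. ennreal (exp ((U w)\<^sup>2 / L\<^sup>2)) \<partial>M) \<le> 2"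
proof -
  have "psi2_norm M U < ennreal L"
    using assms by (meson ennreal_less_iff le_less_trans ennreal_lessI)
  then obtain L' where L': "0 < L'" "ennreal L' < ennreal L"
      "(\<integral>\<^sup>+ w. ennreal (exp ((U w)\<^sup>2 / L'\<^sup>2)) \<partial>M) \<le> 2"
    unfolding psi2_norm_def Inf_less_iff by auto
  then have "L' < L" by (simp add: ennreal_less_iff)
  then have "(U w)\<^sup>2 / L\<^sup>2 \<le> (U w)\<^sup>2 / L'\<^sup>2" for w
    using \<open>0 < L'\<close> by (intro divide_left_mono power_mono) auto
  then have "(\<integral>\<^sup>+ w. ennreal (exp ((U w)\<^sup>2 / L\<^sup>2)) \<partial>M) \<le> (\<integral>\<^sup>+ w. ennreal (exp ((U w)\<^sup>2 / L'\<^sup>2)) \<partial>M)"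
    by (intro nn_integral_mono ennreal_leI) simp
  then show ?thesis using L'(3) by (rule order_trans)
qed

lemma borel_measurable_vinner:
  assumes "sets M = sets (Rd d)"
  shows "(\<lambda>z. vinner d z v) \<in> borel_measurable M"
proof -
  have "(\<lambda>z. vinner d z v) \<in> borel_measurable (Rd d)"
    unfolding vinner_def by measurable
  then show ?thesis by (simp cong: measurable_cong_sets add: assms)
qed

text \<open>Write \<open>u\<close> as its length \<open>r\<close> times a unit vector and apply the
  scalar bound to the projection on that vector, with \<open>s * r\<close> for \<open>s\<close>. If
  \<open>r\<close> is 0, both sides are 1.\<close>

lemma nn_integral_exp_vinner_le:
  assumes "prob_space Q" and Q: "sets Q = sets (Rd d)"
    and cent: "\<And>i. i < d \<Longrightarrow> integrable Q (\<lambda>z. z i) \<and> (\<integral>z. z i \<partial>Q) = 0"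
    and psi: "psi2_vec_norm d Q \<le> ennreal K" and "0 < K"
  shows "(\<integral>\<^sup>+ z. ennreal (exp (s * vinner d z u)) \<partial>Q) \<le> ennreal (exp (4 * K\<^sup>2 * s\<^sup>2 * (\<Sum>i<d. (u i)\<^sup>2)))"
proof -
  interpret prob_space Q by fact
  define r where "r = L2_set u {..<d}"
  have r2: "r\<^sup>2 = (\<Sum>i<d. (u i)\<^sup>2)"
    by (simp add: r_def L2_set_def sum_nonneg)
  have "0 \<le> r" by (simp add: r_def)
  show ?thesis
  proof (cases "r = 0")
    case True
    then have "\<And>i. i < d \<Longrightarrow> u i = 0" using r2 by (simp add: sum_nonneg_eq_0_iff)
    then show ?thesis by (simp add: vinner_def emeasure_space_1)
  next
    case False
    then have "0 < r" using \<open>0 \<le> r\<close> by simp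
    define v where "v = (\<lambda>i\<in>{..<d}. u i / r)"
    have "(\<Sum>i<d. (v i)\<^sup>2) = (\<Sum>i<d. (u i)\<^sup>2) / r\<^sup>2"
      by (simp add: v_def power_divide sum_divide_distrib)
    then have "L2_set v {..<d} = 1"
      using \<open>0 < r\<close> by (simp add: L2_set_def r2[symmetric])
    moreover have "v \<in> space (Rd d)" by (simp add: v_def space_PiM)
    ultimately have "psi2_norm Q (\<lambda>z. vinner d z v) \<le> psi2_vec_norm d Q"
      unfolding psi2_vec_norm_def by (intro SUP_upper) auto
    then have "psi2_norm Q (\<lambda>z. vinner d z v) \<le> ennreal K"
      using psi by (rule order_trans)
    \<comment> \<open>The scale \<open>2 * K\<close> is strictly above \<open>K\<close>, as
      \<open>psi2_norm_leD\<close> requires; it is the source of the factor 4 in the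
      conclusion.\<close>
    then have le: "(\<integral>\<^sup>+ z. ennreal (exp ((vinner d z v)\<^sup>2 / (2 * K)\<^sup>2)) \<partial>Q) \<le> 2"
      by (rule psi2_norm_leD) (use \<open>0 < K\<close> in auto)
    have "(\<integral>\<^sup>+ z. ennreal (exp ((s * r) * vinner d z v)) \<partial>Q) \<le> ennreal (exp ((s * r)\<^sup>2 * (2 * K)\<^sup>2))"
    proof (rule subgaussian_mgf_le[OF borel_measurable_vinner[OF Q] _ _ _ le])
      show "integrable Q (\<lambda>z. vinner d z v)"
        unfolding vinner_def using cent by (intro Bochner_Integration.integrable_sum integrable_mult_left) auto
      show "(\<integral>z. vinner d z v \<partial>Q) = 0"
        unfolding vinner_def using cent by (subst Bochner_Integration.integral_sum) auto
    qed (use \<open>0 < K\<close> in auto)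
    moreover have "(s * r) * vinner d z v = s * vinner d z u" for z
      using \<open>0 < r\<close> by (simp add: vinner_def v_def sum_distrib_left)
    moreover have "(s * r)\<^sup>2 * (2 * K)\<^sup>2 = 4 * K\<^sup>2 * s\<^sup>2 * (\<Sum>i<d. (u i)\<^sup>2)"
      by (simp add: power_mult_distrib r2[symmetric])
    ultimately show ?thesis by (simp only:)
  qed
qed

section \<open>Exponential weights of cycles\<close>

definition cycle_succ :: "'a list \<Rightarrow> nat \<Rightarrow> 'a" where
  "cycle_succ l k = l ! (Suc k mod length l)"

text \<open>The exponents add up to \<open>c\<close> times the cost of \<open>\<pi>\<close> on the
  entries of \<open>l\<close> minus its cost after a shift along \<open>l\<close>. For
  \<open>0 \<le> c\<close> the weight thus dominates the indicator that the shift does not raise the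
  cost, as in a Chernoff bound. The product over positions is the form in which independent noise
  integrates.\<close>

definition cycle_weight ::
    "nat \<Rightarrow> real \<Rightarrow> real \<Rightarrow> nat list \<Rightarrow> (nat \<Rightarrow> nat \<Rightarrow> real) \<Rightarrow> (nat \<Rightarrow> nat \<Rightarrow> real) \<Rightarrow> (nat \<Rightarrow> nat) \<Rightarrow> ennreal" where
  "cycle_weight d c \<sigma> l x z \<pi> = (\<Prod>k<length l. ennreal (exp (c *
     (2 * \<sigma> * vinner d (z (l ! k)) (\<lambda>i. x (\<pi> (cycle_succ l k)) i - x (\<pi> (l ! k)) i)
      - sqdist d (x (\<pi> (cycle_succ l k))) (x (\<pi> (l ! k)))))))"

lemma cycle_succ_in: "l \<noteq> [] \<Longrightarrow> cycle_succ l k \<in> set l"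
  by (simp add: cycle_succ_def)

lemma cycle_weight_ge_1:
  assumes "0 \<le> c"
    and y: "\<And>k i. k < length l \<Longrightarrow> i < d \<Longrightarrow> y (l ! k) i = x (\<pi> (l ! k)) i + \<sigma> * z (l ! k) i"
    and le: "(\<Sum>k<length l. sqdist d (x (\<pi> (cycle_succ l k))) (y (l ! k)))
      \<le> (\<Sum>k<length l. sqdist d (x (\<pi> (l ! k))) (y (l ! k)))"
  shows "1 \<le> cycle_weight d c \<sigma> l x z \<pi>"
proof -
  let ?T = "\<lambda>k. 2 * \<sigma> * vinner d (z (l ! k)) (\<lambda>i. x (\<pi> (cycle_succ l k)) i - x (\<pi> (l ! k)) i)
      - sqdist d (x (\<pi> (cycle_succ l k))) (x (\<pi> (l ! k)))"
  \<comment> \<open>With \<delta> the difference of the two \<open>X\<close>-points, this is the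
    squared length of \<sigma>z minus that of \<sigma>z - \<delta>, expanded.\<close>
  have "sqdist d (x (\<pi> (l ! k))) (y (l ! k)) - sqdist d (x (\<pi> (cycle_succ l k))) (y (l ! k)) = ?T k"
    if "k < length l" for k
    unfolding sqdist_def vinner_def sum_subtractf[symmetric] sum_distrib_left
    by (intro sum.cong refl) (simp add: y[OF that] power2_eq_square algebra_simps)
  then have "(\<Sum>k<length l. ?T k) = (\<Sum>k<length l. sqdist d (x (\<pi> (l ! k))) (y (l ! k))
      - sqdist d (x (\<pi> (cycle_succ l k))) (y (l ! k)))"
    by (intro sum.cong) auto
  then have "0 \<le> (\<Sum>k<length l. ?T k)"
    using le by (simp add: sum_subtractf)
  then have "0 \<le> (\<Sum>k<length l. c * ?T k)"
    using \<open>0 \<le> c\<close> by (simp add: sum_distrib_left[symmetric])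
  then show ?thesis
    by (simp add: cycle_weight_def prod_ennreal exp_sum[symmetric] prod_nonneg)
qed

lemma borel_measurable_coord:
  assumes "sets M = sets (Rd d)" "j \<in> I" "i < d"
  shows "(\<lambda>x. x j i) \<in> borel_measurable (PiM I (\<lambda>_. M))"
proof -
  have "(\<lambda>w. w i) \<in> measurable (Rd d) lborel"
    using \<open>i < d\<close> by (intro measurable_component_singleton) simp
  then have "(\<lambda>w. w i) \<in> borel_measurable M"
    by (simp cong: measurable_cong_sets add: assms)
  then show ?thesis
    using \<open>j \<in> I\<close> by (intro measurable_compose[OF measurable_component_singleton])
qed

lemma borel_measurable_cycle_weight:
  assumes "sets P = sets (Rd d)" "sets Q = sets (Rd d)"
    and "\<pi> permutes {..<n}" "set l \<subseteq> {..<n}"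
  shows "(\<lambda>(x, z). cycle_weight d c \<sigma> l x z \<pi>)
    \<in> borel_measurable (PiM {..<n} (\<lambda>_. P) \<Otimes>\<^sub>M PiM {..<n} (\<lambda>_. Q))"
proof -
  have l: "l ! k < n" "\<pi> (l ! k) < n" "\<pi> (cycle_succ l k) < n" if "k < length l" for k
  proof -
    show "l ! k < n" using that assms(4) nth_mem by blast
    then show "\<pi> (l ! k) < n" using permutes_in_image[OF assms(3)] by auto
    have "cycle_succ l k < n" using that assms(4) cycle_succ_in[of l k] by fastforce
    then show "\<pi> (cycle_succ l k) < n" using permutes_in_image[OF assms(3)] by auto
  qed
  let ?M = "PiM {..<n} (\<lambda>_. P) \<Otimes>\<^sub>M PiM {..<n} (\<lambda>_. Q)"
  have x: "(\<lambda>p. fst p j i) \<in> borel_measurable ?M" if "j < n" "i < d" for i j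
    using that assms by (intro measurable_compose[OF measurable_fst] borel_measurable_coord) auto
  have z: "(\<lambda>p. snd p j i) \<in> borel_measurable ?M" if "j < n" "i < d" for i j
    using that assms by (intro measurable_compose[OF measurable_snd] borel_measurable_coord) auto
  show ?thesis
    unfolding cycle_weight_def case_prod_beta vinner_def sqdist_def
    by (intro borel_measurable_prod_ennreal measurable_compose[OF _ measurable_ennreal]
        measurable_compose[OF _ borel_measurable_exp] borel_measurable_times
        borel_measurable_diff borel_measurable_const borel_measurable_sum borel_measurable_power x z l) auto
qed

section \<open>Integration of the weights over the noise and the points\<close>

text \<open>For fixed \<open>x\<close> the noises at distinct entries are independent. With
  parameter \<open>c\<close>, an edge of squared length S contributes at most exp(-c S + 16 K^2
  \<sigma>^2 c^2 S). This is smallest at \<open>c = 2 * a\<close>, where it equals exp(-a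
  S).\<close>

lemma nn_integral_cycle_weight_noise_le:
  fixes \<sigma> K :: real
  assumes "prob_space Q" and Q: "sets Q = sets (Rd d)"
    and cent: "\<And>i. i < d \<Longrightarrow> integrable Q (\<lambda>z. z i) \<and> (\<integral>z. z i \<partial>Q) = 0"
    and psi: "psi2_vec_norm d Q \<le> ennreal K" and "0 < K" "0 < \<sigma>"
    and l: "distinct l" "set l \<subseteq> {..<n}" "2 \<le> length l"
    and a: "a = 1 / (64 * K\<^sup>2 * \<sigma>\<^sup>2)"
  shows "(\<integral>\<^sup>+ z. cycle_weight d (2 * a) \<sigma> l x z \<pi> \<partial>PiM {..<n} (\<lambda>_. Q))
    \<le> (\<Prod>k<length l - 1. ennreal (exp (- a * sqdist d (x (\<pi> (l ! k))) (x (\<pi> (l ! Suc k))))))"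
proof -
  interpret prob_space Q by fact
  define S where "S = (\<lambda>k. sqdist d (x (\<pi> (cycle_succ l k))) (x (\<pi> (l ! k))))"
  define V where "V = (\<lambda>k z. vinner d z (\<lambda>i. x (\<pi> (cycle_succ l k)) i - x (\<pi> (l ! k)) i))"
  have "0 \<le> a" by (simp add: a)
  have Vm: "V k \<in> borel_measurable Q" for k
    unfolding V_def by (rule borel_measurable_vinner[OF Q])
  have "(\<integral>\<^sup>+ z. cycle_weight d (2 * a) \<sigma> l x z \<pi> \<partial>PiM {..<n} (\<lambda>_. Q))
      = (\<Prod>k<length l. \<integral>\<^sup>+ z. ennreal (exp (2 * a * (2 * \<sigma> * V k z - S k))) \<partial>Q)"
    using nn_integral_PiM_distinct[OF _ l(1,2), of "\<lambda>k z. ennreal (exp (2 * a * (2 * \<sigma> * V k z - S k)))"] Vm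
    by (simp add: V_def S_def cycle_weight_def)
  also have "\<dots> \<le> (\<Prod>k<length l. ennreal (exp (- a * S k)))"
  proof (intro prod_mono_ennreal)
    fix k
    have "(\<integral>\<^sup>+ z. ennreal (exp (2 * a * (2 * \<sigma> * V k z - S k))) \<partial>Q)
        = (\<integral>\<^sup>+ z. ennreal (exp (- 2 * a * S k)) * ennreal (exp ((4 * a * \<sigma>) * V k z)) \<partial>Q)"
      by (intro nn_integral_cong) (simp add: ennreal_mult[symmetric] exp_add[symmetric] algebra_simps)
    also have "\<dots> = ennreal (exp (- 2 * a * S k)) * (\<integral>\<^sup>+ z. ennreal (exp ((4 * a * \<sigma>) * V k z)) \<partial>Q)"
      using Vm by (intro nn_integral_cmult) simp
    also have "\<dots> \<le> ennreal (exp (- 2 * a * S k)) * ennreal (exp (4 * K\<^sup>2 * (4 * a * \<sigma>)\<^sup>2 * S k))"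
      unfolding V_def S_def sqdist_def
      by (intro mult_left_mono nn_integral_exp_vinner_le[OF assms(1-5)]) auto
    also have "4 * K\<^sup>2 * (4 * a * \<sigma>)\<^sup>2 = a"
      using \<open>0 < K\<close> \<open>0 < \<sigma>\<close> by (simp add: a field_simps power2_eq_square)
    also have "ennreal (exp (- 2 * a * S k)) * ennreal (exp (a * S k)) = ennreal (exp (- a * S k))"
      by (simp add: ennreal_mult[symmetric] exp_add[symmetric])
    finally show "(\<integral>\<^sup>+ z. ennreal (exp (2 * a * (2 * \<sigma> * V k z - S k))) \<partial>Q) \<le> ennreal (exp (- a * S k))" .
  qed
  \<comment> \<open>The last position carries the edge that closes the cycle; its factor is at most
    1 and is dropped.\<close>
  also have "\<dots> = (\<Prod>k<length l - 1. ennreal (exp (- a * S k))) * ennreal (exp (- a * S (length l - 1)))"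
    using l(3) by (cases "length l") auto
  also have "\<dots> \<le> (\<Prod>k<length l - 1. ennreal (exp (- a * S k))) * 1"
    using \<open>0 \<le> a\<close> by (intro mult_left_mono) (auto simp: S_def sqdist_nonneg)
  also have "\<dots> = (\<Prod>k<length l - 1. ennreal (exp (- a * sqdist d (x (\<pi> (l ! k))) (x (\<pi> (l ! Suc k))))))"
    by (simp, intro prod.cong) (auto simp: S_def cycle_succ_def sqdist_commute)
  finally show ?thesis .
qed

text \<open>Since \<pi> is injective, \<open>map \<pi> l\<close> again has distinct entries and the
  path bound applies to it. One edge integrates to at most \<open>B\<close> times a Gaussian
  integral, whose value does not depend on the other endpoint.\<close>

lemma nn_integral_path_weight_le:
  fixes l :: "nat list"
  assumes P: "P = density (Rd d) (\<lambda>x. ennreal (f x))" and f: "f \<in> borel_measurable (Rd d)"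
    and "prob_space P" and B: "esssup (Rd d) (\<lambda>x. ereal (f x)) \<le> ereal B"
    and l: "distinct l" "set l \<subseteq> {..<n}" "l \<noteq> []" and "0 < a"
    and \<pi>: "\<pi> permutes {..<n}" and q: "ennreal B * ennreal (sqrt (pi / a) ^ d) \<le> q"
  shows "(\<integral>\<^sup>+ x. (\<Prod>k<length l - 1. ennreal (exp (- a * sqdist d (x (\<pi> (l ! k))) (x (\<pi> (l ! Suc k)))))) \<partial>PiM {..<n} (\<lambda>_. P))
    \<le> q ^ (length l - 1)"
proof -
  interpret prob_space P by fact
  define h where "h = (\<lambda>y w. ennreal (exp (- a * sqdist d y w)))"
  have hm: "case_prod h \<in> borel_measurable (Rd d \<Otimes>\<^sub>M Rd d)"
    unfolding h_def sqdist_def by measurable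
  have hP: "case_prod h \<in> borel_measurable (P \<Otimes>\<^sub>M P)"
    using hm by (simp add: P cong: measurable_cong_sets sets_pair_measure_cong)
  have hle: "(\<integral>\<^sup>+ y. h y w \<partial>P) \<le> q" if "w \<in> space P" for w
  proof -
    have "w \<in> space (Rd d)" using that by (simp add: P)
    then have "(\<lambda>y. h y w) \<in> borel_measurable (Rd d)"
      using measurable_compose[OF measurable_Pair2' hm] by simp
    then have "(\<integral>\<^sup>+ y. h y w \<partial>P) \<le> ennreal B * (\<integral>\<^sup>+ y. h y w \<partial>Rd d)"
      unfolding P by (intro nn_integral_density_le_esssup f B)
    also have "\<dots> \<le> q"
      unfolding h_def nn_integral_Rd_gaussian[OF \<open>0 < a\<close>] by (rule q)
    finally show ?thesis .
  qed
  have "(\<integral>\<^sup>+ x. (\<Prod>k<length (map \<pi> l) - 1. h (x (map \<pi> l ! k)) (x (map \<pi> l ! Suc k))) \<partial>PiM {..<n} (\<lambda>_. P))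
      \<le> q ^ (length (map \<pi> l) - 1)"
  proof (rule nn_integral_PiM_path[OF _ _ _ _ hP hle])
    show "distinct (map \<pi> l)" using l \<pi> by (simp add: distinct_map permutes_inj_on)
    show "set (map \<pi> l) \<subseteq> {..<n}" using l permutes_in_image[OF \<pi>] by fastforce
  qed (use l in auto)
  moreover have "(\<Prod>k<length l - 1. h (x (map \<pi> l ! k)) (x (map \<pi> l ! Suc k)))
     = (\<Prod>k<length l - 1. h (x (\<pi> (l ! k))) (x (\<pi> (l ! Suc k))))" for x
    by (intro prod.cong) auto
  ultimately show ?thesis by (simp add: h_def)
qed

section \<open>Splitting by the value of the uniform permutation\<close>

lemma borel_measurable_times_indicator_pair:
  assumes "\<pi> \<in> A" and g: "case_prod g \<in> borel_measurable (M \<Otimes>\<^sub>M N)"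
  shows "(\<lambda>(x, z, \<rho>). g x z * indicator {\<pi>} \<rho> :: ennreal)
    \<in> borel_measurable (M \<Otimes>\<^sub>M N \<Otimes>\<^sub>M uniform_count_measure A)"
proof -
  let ?U = "uniform_count_measure A"
  have "(indicator {\<pi>} :: _ \<Rightarrow> ennreal) \<in> borel_measurable ?U"
    using assms by (intro borel_measurable_indicator) (auto simp: sets_uniform_count_measure)
  then have "(\<lambda>p. indicator {\<pi>} (snd (snd p)) :: ennreal) \<in> borel_measurable (M \<Otimes>\<^sub>M N \<Otimes>\<^sub>M ?U)"
    by (intro measurable_compose[OF measurable_compose[OF measurable_snd measurable_snd]])
  moreover have "(\<lambda>p. (fst p, fst (snd p))) \<in> measurable (M \<Otimes>\<^sub>M N \<Otimes>\<^sub>M ?U) (M \<Otimes>\<^sub>M N)"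
    by measurable
  from measurable_compose[OF this g]
  have "(\<lambda>p. g (fst p) (fst (snd p))) \<in> borel_measurable (M \<Otimes>\<^sub>M N \<Otimes>\<^sub>M ?U)"
    by simp
  ultimately show ?thesis
    unfolding case_prod_beta by (intro borel_measurable_times_ennreal)
qed

text \<open>Tonelli with the permutation innermost: the indicator leaves the mass of one point, so
  the integrand is handled at one fixed permutation at a time.\<close>

lemma nn_integral_uniform_pair:
  assumes "sigma_finite_measure N" "finite A" "\<pi> \<in> A"
    and g: "case_prod g \<in> borel_measurable (M \<Otimes>\<^sub>M N)"
  shows "(\<integral>\<^sup>+ (x, z, \<rho>). g x z * indicator {\<pi>} \<rho> \<partial>(M \<Otimes>\<^sub>M N \<Otimes>\<^sub>M uniform_count_measure A))
    = (\<integral>\<^sup>+ x. \<integral>\<^sup>+ z. g x z \<partial>N \<partial>M) * ennreal (1 / card A)"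
proof -
  let ?U = "uniform_count_measure A"
  interpret N: sigma_finite_measure N by fact
  interpret U: prob_space ?U using assms by (intro prob_space_uniform_count_measure) auto
  interpret NU: pair_sigma_finite N ?U ..
  have ind: "(indicator {\<pi>} :: _ \<Rightarrow> ennreal) \<in> borel_measurable ?U"
    using assms by (intro borel_measurable_indicator) (auto simp: sets_uniform_count_measure)
  have emU: "emeasure ?U {\<pi>} = ennreal (1 / card A)"
    using assms by (simp add: emeasure_uniform_count_measure)
  note gm = borel_measurable_times_indicator_pair[OF \<open>\<pi> \<in> A\<close> g]
  have inner: "(\<integral>\<^sup>+ p. g x (fst p) * indicator {\<pi>} (snd p) \<partial>(N \<Otimes>\<^sub>M ?U))
      = (\<integral>\<^sup>+ z. g x z \<partial>N) * ennreal (1 / card A)" if "x \<in> space M" for x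
  proof -
    have gx: "g x \<in> borel_measurable N"
      using measurable_compose[OF measurable_Pair1'[OF that] g] by simp
    have "(\<integral>\<^sup>+ p. g x (fst p) * indicator {\<pi>} (snd p) \<partial>(N \<Otimes>\<^sub>M ?U))
        = (\<integral>\<^sup>+ z. \<integral>\<^sup>+ \<rho>. g x z * indicator {\<pi>} \<rho> \<partial>?U \<partial>N)"
      by (subst U.nn_integral_fst[symmetric])
        (auto intro!: borel_measurable_times_ennreal measurable_compose[OF measurable_fst gx]
          measurable_compose[OF measurable_snd ind])
    also have "\<dots> = (\<integral>\<^sup>+ z. g x z * ennreal (1 / card A) \<partial>N)"
      using assms by (simp add: nn_integral_cmult_indicator sets_uniform_count_measure emU)
    also have "\<dots> = (\<integral>\<^sup>+ z. g x z \<partial>N) * ennreal (1 / card A)"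
      by (rule nn_integral_multc[OF gx])
    finally show ?thesis .
  qed
  have "(\<integral>\<^sup>+ (x, z, \<rho>). g x z * indicator {\<pi>} \<rho> \<partial>(M \<Otimes>\<^sub>M N \<Otimes>\<^sub>M ?U))
      = (\<integral>\<^sup>+ x. (\<integral>\<^sup>+ p. g x (fst p) * indicator {\<pi>} (snd p) \<partial>(N \<Otimes>\<^sub>M ?U)) \<partial>M)"
    using NU.sigma_finite_measure_axioms gm
    by (subst sigma_finite_measure.nn_integral_fst[symmetric]) (auto simp: case_prod_beta)
  also have "\<dots> = (\<integral>\<^sup>+ x. (\<integral>\<^sup>+ z. g x z \<partial>N) * ennreal (1 / card A) \<partial>M)"
    by (intro nn_integral_cong inner)
  also have "\<dots> = (\<integral>\<^sup>+ x. \<integral>\<^sup>+ z. g x z \<partial>N \<partial>M) * ennreal (1 / card A)"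
    using N.borel_measurable_nn_integral_fst[OF g] by (intro nn_integral_multc) simp
  finally show ?thesis .
qed

section \<open>Counting the lists\<close>

text \<open>A cycle enters once for each starting point, so that a mismatch \<open>j\<close> can be
  charged to a list with head \<open>j\<close>.\<close>

definition cycle_lists :: "nat \<Rightarrow> nat list set" where
  "cycle_lists n = {l. distinct l \<and> set l \<subseteq> {..<n} \<and> 2 \<le> length l}"

lemma length_cycle_lists_le: "l \<in> cycle_lists n \<Longrightarrow> length l \<le> n"
  using card_mono[of "{..<n}" "set l"] by (simp add: cycle_lists_def distinct_card)

lemma finite_cycle_lists: "finite (cycle_lists n)"
proof -
  have "cycle_lists n \<subseteq> {l. set l \<subseteq> {..<n} \<and> length l \<le> n}"
    using length_cycle_lists_le by (auto simp: cycle_lists_def)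
  then show ?thesis
    by (rule finite_subset) (rule finite_lists_length_le, simp)
qed

text \<open>As lengths are at least 2, one factor \<open>n * q\<close> can be kept while the others
  are replaced by 1/2; the remaining geometric series is at most 2.\<close>

lemma sum_cycle_lists_le:
  fixes q :: real
  assumes "0 \<le> q" "n * q \<le> 1 / 2"
  shows "(\<Sum>l\<in>cycle_lists n. q ^ (length l - 1)) \<le> 2 * (real n)\<^sup>2 * q"
proof -
  have "(\<Sum>l\<in>cycle_lists n. q ^ (length l - 1))
      = (\<Sum>t\<in>{2..n}. \<Sum>l\<in>{l\<in>cycle_lists n. length l = t}. q ^ (length l - 1))"
    by (rule sum.group[symmetric]) (use finite_cycle_lists length_cycle_lists_le in \<open>auto simp: cycle_lists_def\<close>)
  also have "\<dots> = (\<Sum>t\<in>{2..n}. card {l\<in>cycle_lists n. length l = t} * q ^ (t - 1))"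
    by (intro sum.cong) auto
  also have "\<dots> \<le> (\<Sum>t\<in>{2..n}. real (n ^ t) * q ^ (t - 1))"
  proof (intro sum_mono mult_right_mono)
    fix t
    have "card {l\<in>cycle_lists n. length l = t} \<le> card {l. set l \<subseteq> {..<n} \<and> length l = t}"
      by (intro card_mono finite_lists_length_eq) (auto simp: cycle_lists_def)
    also have "\<dots> = n ^ t"
      by (simp add: card_lists_length_eq)
    finally show "real (card {l\<in>cycle_lists n. length l = t}) \<le> real (n ^ t)"
      by (rule of_nat_mono)
  qed (use assms in auto)
  also have "\<dots> = (\<Sum>t\<in>{2..n}. n * (n * q) ^ (t - 1))"
  proof (intro sum.cong refl)
    fix t assume "t \<in> {2..n}"
    then have "real (n ^ t) = n * n ^ (t - 1)" by (cases t) auto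
    then show "real (n ^ t) * q ^ (t - 1) = n * (n * q) ^ (t - 1)"
      by (simp add: power_mult_distrib)
  qed
  also have "\<dots> \<le> (\<Sum>t\<in>{2..n}. n * ((n * q) * (1 / 2) ^ (t - 2)))"
  proof (intro sum_mono mult_left_mono)
    fix t assume "t \<in> {2..n}"
    then have "t - 1 = Suc (t - 2)" by auto
    then have "(n * q) ^ (t - 1) = (n * q) * (n * q) ^ (t - 2)"
      by (simp only: power_Suc)
    also have "\<dots> \<le> (n * q) * (1 / 2) ^ (t - 2)"
      using assms by (intro mult_left_mono power_mono) auto
    finally show "(n * q) ^ (t - 1) \<le> (n * q) * (1 / 2) ^ (t - 2)" .
  qed auto
  also have "\<dots> = n * (n * q) * (\<Sum>t\<in>{2..n}. (1 / 2) ^ (t - 2))"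
    by (simp add: sum_distrib_left mult_ac)
  also have "\<dots> \<le> n * (n * q) * 2"
  proof (intro mult_left_mono)
    have "(\<Sum>t\<in>{2..n}. (1 / 2 :: real) ^ (t - 2)) = (\<Sum>t<n - 1. (1 / 2) ^ t)"
      by (rule sum.reindex_bij_witness[of _ "\<lambda>t. t + 2" "\<lambda>t. t - 2"]) auto
    also have "\<dots> \<le> 2"
      by (subst geometric_sum) (auto simp: field_simps)
    finally show "(\<Sum>t\<in>{2..n}. (1 / 2 :: real) ^ (t - 2)) \<le> 2" .
  qed (use assms in auto)
  finally show ?thesis by (simp add: power2_eq_square mult_ac)
qed

section \<open>From the Hamming distance to the risk\<close>

lemma hamming_le: "hamming n \<pi> \<pi>' \<le> n"
  using sum_bounded_above[of "{..<n}" "\<lambda>j. of_bool (\<pi> j \<noteq> \<pi>' j)" "1::nat"] by (simp add: hamming_def)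

text \<open>Each mismatch is the head of a list of weight at least 1. Hence the mismatches are at
  most as many as these lists, and these at most the sum of all weights.\<close>

lemma hamming_le_cycle_weight_sum:
  assumes est: "is_LSS d n est" and x: "x \<in> space (PiM {..<n} (\<lambda>_. Rd d))"
    and \<pi>: "\<pi> permutes {..<n}" and "0 \<le> c"
  shows "ennreal (hamming n (est (x, LDS_obs d n \<sigma> x z \<pi>)) \<pi>)
    \<le> (\<Sum>l\<in>cycle_lists n. cycle_weight d c \<sigma> l x z \<pi>)"
proof -
  define y where "y = LDS_obs d n \<sigma> x z \<pi>"
  define p where "p = est (x, y)"
  have y: "y j i = x (\<pi> j) i + \<sigma> * z j i" if "j < n" "i < d" for j i
    using that by (simp add: y_def LDS_obs_def vadd_def vscale_def)
  have "y \<in> space (PiM {..<n} (\<lambda>_. Rd d))"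
    by (auto simp: y_def LDS_obs_def vadd_def space_PiM)
  then have "is_arg_min (\<lambda>\<pi>. \<Sum>j<n. (L2_set (\<lambda>i. x (\<pi> j) i - y j i) {..<d})\<^sup>2) (\<lambda>\<pi>. \<pi> permutes {..<n}) p"
    using est x unfolding is_LSS_def p_def by blast
  moreover have "(L2_set (\<lambda>i. v i - w i) {..<d})\<^sup>2 = sqdist d v w" for v w :: "nat \<Rightarrow> real"
    by (simp add: L2_set_def sqdist_def sum_nonneg)
  ultimately have p: "p permutes {..<n}"
    and opt: "\<And>r. r permutes {..<n} \<Longrightarrow> (\<Sum>j<n. sqdist d (x (p j)) (y j)) \<le> (\<Sum>j<n. sqdist d (x (r j)) (y j))"
    by (auto simp: is_arg_min_def not_less)
  define C where "C = {l \<in> cycle_lists n. 1 \<le> cycle_weight d c \<sigma> l x z \<pi>}"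
  have "\<exists>l\<in>C. hd l = j" if j: "p j \<noteq> \<pi> j" for j
  proof -
    obtain l where l: "distinct l" "set l \<subseteq> {..<n}" "2 \<le> length l" "hd l = j"
      and le: "(\<Sum>k<length l. sqdist d (x (\<pi> (l ! (Suc k mod length l)))) (y (l ! k)))
        \<le> (\<Sum>k<length l. sqdist d (x (\<pi> (l ! k))) (y (l ! k)))"
      by (rule optimal_assignment_cycle[where c = "\<lambda>i j. sqdist d (x i) (y j)", OF _ p \<pi> opt j]) auto
    have "l ! k < n" if "k < length l" for k
      using that l(2) nth_mem by blast
    then have "1 \<le> cycle_weight d c \<sigma> l x z \<pi>"
      using le \<open>0 \<le> c\<close> by (intro cycle_weight_ge_1[where y = y]) (auto simp: y cycle_succ_def)
    then show ?thesis using l by (auto simp: C_def cycle_lists_def)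
  qed
  then have "{j. j < n \<and> p j \<noteq> \<pi> j} \<subseteq> hd ` C" by blast
  moreover have "finite C" using finite_cycle_lists by (simp add: C_def)
  ultimately have "card {j. j < n \<and> p j \<noteq> \<pi> j} \<le> card C"
    by (meson card_image_le card_mono finite_imageI order_trans)
  then have "hamming n p \<pi> \<le> card C"
    by (simp add: hamming_def sum.If_cases of_bool_def lessThan_def Collect_conj_eq)
  then have "ennreal (hamming n p \<pi>) \<le> ennreal (card C)"
    by (intro ennreal_leI) simp
  also have "\<dots> = (\<Sum>l\<in>C. 1)"
    by (simp add: ennreal_of_nat_eq_real_of_nat)
  also have "\<dots> \<le> (\<Sum>l\<in>C. cycle_weight d c \<sigma> l x z \<pi>)"
    by (intro sum_mono) (simp add: C_def)
  also have "\<dots> \<le> (\<Sum>l\<in>cycle_lists n. cycle_weight d c \<sigma> l x z \<pi>)"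
    by (intro sum_mono2 finite_cycle_lists) (auto simp: C_def)
  finally show ?thesis by (simp add: p_def y_def)
qed

text \<open>If \<open>f\<close> is not integrable, its Bochner integral is 0 by convention, and
  \<open>0 \<le> b\<close> gives the bound.\<close>

lemma (in prob_space) integral_le_of_nn_integral_le:
  fixes f :: "'a \<Rightarrow> real"
  assumes "\<And>w. w \<in> space M \<Longrightarrow> 0 \<le> f w" "(\<integral>\<^sup>+ w. ennreal (f w) \<partial>M) \<le> ennreal b" "0 \<le> b"
  shows "expectation f \<le> b"
proof (cases "integrable M f")
  case True
  then have "ennreal (expectation f) = (\<integral>\<^sup>+ w. ennreal (f w) \<partial>M)"
    using assms(1) by (intro nn_integral_eq_integral[symmetric]) auto
  then show ?thesis using assms by (metis ennreal_le_iff)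
qed (use assms in \<open>simp add: not_integrable_integral_eq\<close>)

text \<open>The trivial first bound also feeds the second, in the range where the sum over lists is
  not controlled.\<close>

lemma LSS_risk_le:
  assumes "0 < \<sigma>" and A: "LDS_assumptions d N R \<gamma> \<beta> K P Q" and "0 < K" and est: "is_LSS d n est"
  shows "LSS_risk d n \<sigma> P Q est \<le> n"
    and "LSS_risk d n \<sigma> P Q est \<le> 2 * (real n)\<^sup>2 * (16 * K * \<sigma> * exp \<beta>) ^ d"
proof -
  from A obtain f where f: "f \<in> borel_measurable (Rd d)" and P: "P = density (Rd d) (\<lambda>x. ennreal (f x))"
    and fB: "esssup (Rd d) (\<lambda>x. ereal (f x)) \<le> ereal (exp (\<beta> * real d))"
    unfolding LDS_assumptions_def by blast
  from A have "prob_space P" "prob_space Q" and Q: "sets Q = sets (Rd d)"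
    and cent: "\<And>i. i < d \<Longrightarrow> integrable Q (\<lambda>z. z i) \<and> (\<integral>z. z i \<partial>Q) = 0"
    and psi: "psi2_vec_norm d Q \<le> ennreal K"
    unfolding LDS_assumptions_def by blast+
  define S where "S = {\<pi>. \<pi> permutes {..<n}}"
  have "finite S" by (simp add: S_def finite_permutations)
  moreover have "id \<in> S" by (simp add: S_def permutes_id)
  ultimately have cardS: "0 < card S" by (auto simp: card_gt_0_iff)
  let ?U = "uniform_count_measure S"
  let ?Ps = "PiM {..<n} (\<lambda>_. P)" and ?Qs = "PiM {..<n} (\<lambda>_. Q)"
  interpret Ps: prob_space ?Ps using \<open>prob_space P\<close> by (rule prob_space_PiM)
  interpret Qs: prob_space ?Qs using \<open>prob_space Q\<close> by (rule prob_space_PiM)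
  interpret U: prob_space ?U
    using \<open>finite S\<close> \<open>id \<in> S\<close> by (intro prob_space_uniform_count_measure) auto
  interpret QU: pair_prob_space ?Qs ?U ..
  interpret L: pair_prob_space ?Ps "?Qs \<Otimes>\<^sub>M ?U" ..
  define W where "W = (\<lambda>(x, z, \<pi>). real (hamming n (est (x, LDS_obs d n \<sigma> x z \<pi>)) \<pi>))"
  have risk: "LSS_risk d n \<sigma> P Q est = L.expectation W"
    by (simp add: LSS_risk_def LDS_law_def W_def S_def)
  have "W w \<le> n" for w
    by (simp add: W_def hamming_le split: prod.split)
  moreover have "0 \<le> W w" for w by (simp add: W_def split: prod.split)
  ultimately have bound_n: "L.expectation W \<le> n"
  proof (intro L.integral_le_of_nn_integral_le)
    assume "\<And>w. W w \<le> n"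
    then have "(\<integral>\<^sup>+ w. ennreal (W w) \<partial>(?Ps \<Otimes>\<^sub>M ?Qs \<Otimes>\<^sub>M ?U)) \<le> (\<integral>\<^sup>+ w. ennreal n \<partial>(?Ps \<Otimes>\<^sub>M ?Qs \<Otimes>\<^sub>M ?U))"
      by (intro nn_integral_mono ennreal_leI)
    then show "(\<integral>\<^sup>+ w. ennreal (W w) \<partial>(?Ps \<Otimes>\<^sub>M ?Qs \<Otimes>\<^sub>M ?U)) \<le> ennreal n"
      by (simp add: L.emeasure_space_1)
  qed auto
  then show "LSS_risk d n \<sigma> P Q est \<le> n" by (simp add: risk)

  define q where "q = (16 * K * \<sigma> * exp \<beta>) ^ d"
  have "0 \<le> q" using \<open>0 < K\<close> \<open>0 < \<sigma>\<close> by (simp add: q_def)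
  define a where "a = 1 / (64 * K\<^sup>2 * \<sigma>\<^sup>2)"
  have "0 < a" using \<open>0 < K\<close> \<open>0 < \<sigma>\<close> by (simp add: a_def)
  \<comment> \<open>The left side is \<open>8 * sqrt pi * K * \<sigma>\<close>, and
    \<open>pi < 4\<close>; this is the origin of 16.\<close>
  have "sqrt (pi / a) \<le> 16 * K * \<sigma>"
  proof (rule real_le_lsqrt)
    have "pi * (64 * K\<^sup>2 * \<sigma>\<^sup>2) \<le> 4 * (64 * K\<^sup>2 * \<sigma>\<^sup>2)"
      using pi_less_4 by (intro mult_right_mono) auto
    then show "pi / a \<le> (16 * K * \<sigma>)\<^sup>2"
      by (simp add: a_def power_mult_distrib)
  qed (use \<open>0 < K\<close> \<open>0 < \<sigma>\<close> in auto)
  then have "exp (\<beta> * d) * sqrt (pi / a) ^ d \<le> exp (\<beta> * d) * (16 * K * \<sigma>) ^ d"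
    using \<open>0 < a\<close> by (intro mult_left_mono power_mono) auto
  also have "\<dots> = q"
    by (simp add: q_def power_mult_distrib exp_of_nat_mult[symmetric] mult_ac)
  finally have q: "ennreal (exp (\<beta> * d)) * ennreal (sqrt (pi / a) ^ d) \<le> ennreal q"
    using \<open>0 < a\<close> by (simp add: ennreal_mult[symmetric] ennreal_leI)
  have weight: "(\<integral>\<^sup>+ x. \<integral>\<^sup>+ z. cycle_weight d (2 * a) \<sigma> l x z \<pi> \<partial>?Qs \<partial>?Ps) \<le> ennreal (q ^ (length l - 1))"
    if "\<pi> \<in> S" "l \<in> cycle_lists n" for \<pi> l
  proof -
    have l: "distinct l" "set l \<subseteq> {..<n}" "2 \<le> length l" "l \<noteq> []" and \<pi>: "\<pi> permutes {..<n}"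
      using that by (auto simp: cycle_lists_def S_def)
    have "(\<integral>\<^sup>+ x. \<integral>\<^sup>+ z. cycle_weight d (2 * a) \<sigma> l x z \<pi> \<partial>?Qs \<partial>?Ps)
      \<le> (\<integral>\<^sup>+ x. (\<Prod>k<length l - 1. ennreal (exp (- a * sqdist d (x (\<pi> (l ! k))) (x (\<pi> (l ! Suc k)))))) \<partial>?Ps)"
      by (intro nn_integral_mono nn_integral_cycle_weight_noise_le[OF \<open>prob_space Q\<close> Q cent psi
            \<open>0 < K\<close> \<open>0 < \<sigma>\<close> l(1-3) a_def])
    also have "\<dots> \<le> ennreal q ^ (length l - 1)"
      by (rule nn_integral_path_weight_le[OF P f \<open>prob_space P\<close> fB l(1,2,4) \<open>0 < a\<close> \<pi> q])
    finally show ?thesis using \<open>0 \<le> q\<close> by (simp add: ennreal_power)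
  qed
  \<comment> \<open>The weight is restricted to the event that the true permutation is
    \<open>\<pi>'\<close>.\<close>
  define T where "T = (\<lambda>l \<pi>' (x, z, \<pi>). cycle_weight d (2 * a) \<sigma> l x z \<pi>' * indicator {\<pi>'} \<pi> :: ennreal)"
  have setsP: "sets P = sets (Rd d)" by (simp add: P)
  have T: "T l \<pi> \<in> borel_measurable (?Ps \<Otimes>\<^sub>M ?Qs \<Otimes>\<^sub>M ?U)"
    and Tle: "(\<integral>\<^sup>+ w. T l \<pi> w \<partial>(?Ps \<Otimes>\<^sub>M ?Qs \<Otimes>\<^sub>M ?U)) \<le> ennreal (q ^ (length l - 1)) * ennreal (1 / card S)"
    if "\<pi> \<in> S" "l \<in> cycle_lists n" for \<pi> l
  proof -
    have g: "case_prod (\<lambda>x z. cycle_weight d (2 * a) \<sigma> l x z \<pi>) \<in> borel_measurable (?Ps \<Otimes>\<^sub>M ?Qs)"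
      using that by (intro borel_measurable_cycle_weight setsP Q) (auto simp: S_def cycle_lists_def)
    show "T l \<pi> \<in> borel_measurable (?Ps \<Otimes>\<^sub>M ?Qs \<Otimes>\<^sub>M ?U)"
      unfolding T_def by (rule borel_measurable_times_indicator_pair[OF that(1) g])
    have "(\<integral>\<^sup>+ w. T l \<pi> w \<partial>(?Ps \<Otimes>\<^sub>M ?Qs \<Otimes>\<^sub>M ?U))
        = (\<integral>\<^sup>+ x. \<integral>\<^sup>+ z. cycle_weight d (2 * a) \<sigma> l x z \<pi> \<partial>?Qs \<partial>?Ps) * ennreal (1 / card S)"
      unfolding T_def by (rule nn_integral_uniform_pair[OF _ \<open>finite S\<close> that(1) g]) unfold_locales
    also have "\<dots> \<le> ennreal (q ^ (length l - 1)) * ennreal (1 / card S)"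
      using weight[OF that] by (rule mult_right_mono) simp
    finally show "(\<integral>\<^sup>+ w. T l \<pi> w \<partial>(?Ps \<Otimes>\<^sub>M ?Qs \<Otimes>\<^sub>M ?U)) \<le> ennreal (q ^ (length l - 1)) * ennreal (1 / card S)" .
  qed
  have spaceP: "space P = space (Rd d)" by (simp add: P)
  have WT: "ennreal (W w) \<le> (\<Sum>l\<in>cycle_lists n. \<Sum>\<pi>\<in>S. T l \<pi> w)" if "w \<in> space (?Ps \<Otimes>\<^sub>M ?Qs \<Otimes>\<^sub>M ?U)" for w
  proof -
    obtain x z \<pi> where w: "w = (x, z, \<pi>)" by (cases w)
    have "x \<in> space (PiM {..<n} (\<lambda>_. Rd d))" and "\<pi> \<in> S"
      using that by (auto simp: w space_pair_measure space_PiM spaceP space_uniform_count_measure)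
    then have "ennreal (W w) \<le> (\<Sum>l\<in>cycle_lists n. cycle_weight d (2 * a) \<sigma> l x z \<pi>)"
      unfolding W_def w prod.case using \<open>0 < a\<close>
      by (intro hamming_le_cycle_weight_sum[OF est]) (auto simp: S_def)
    \<comment> \<open>At \<open>w\<close> the indicator in \<open>T\<close> is 1 for its own
      permutation, so that single term recovers the weight.\<close>
    also have "\<dots> = (\<Sum>l\<in>cycle_lists n. \<Sum>\<pi>'\<in>{\<pi>}. T l \<pi>' w)"
      by (simp add: T_def w)
    also have "\<dots> \<le> (\<Sum>l\<in>cycle_lists n. \<Sum>\<pi>\<in>S. T l \<pi> w)"
      using \<open>\<pi> \<in> S\<close> \<open>finite S\<close> by (intro sum_mono sum_mono2) auto
    finally show ?thesis .
  qed
  have "(\<integral>\<^sup>+ w. ennreal (W w) \<partial>(?Ps \<Otimes>\<^sub>M ?Qs \<Otimes>\<^sub>M ?U))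
      \<le> (\<integral>\<^sup>+ w. (\<Sum>l\<in>cycle_lists n. \<Sum>\<pi>\<in>S. T l \<pi> w) \<partial>(?Ps \<Otimes>\<^sub>M ?Qs \<Otimes>\<^sub>M ?U))"
    by (intro nn_integral_mono WT)
  also have "\<dots> = (\<Sum>l\<in>cycle_lists n. \<Sum>\<pi>\<in>S. \<integral>\<^sup>+ w. T l \<pi> w \<partial>(?Ps \<Otimes>\<^sub>M ?Qs \<Otimes>\<^sub>M ?U))"
    using T by (simp add: nn_integral_sum)
  also have "\<dots> \<le> (\<Sum>l\<in>cycle_lists n. \<Sum>\<pi>\<in>S. ennreal (q ^ (length l - 1)) * ennreal (1 / card S))"
    by (intro sum_mono Tle)
  \<comment> \<open>The bound is the same for every permutation, so the masses
    \<open>1 / card S\<close> add up to 1.\<close>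
  also have "\<dots> = (\<Sum>l\<in>cycle_lists n. ennreal (q ^ (length l - 1)))"
  proof (intro sum.cong refl)
    fix l
    have "(\<Sum>\<pi>\<in>S. ennreal (q ^ (length l - 1)) * ennreal (1 / card S))
        = ennreal (\<Sum>\<pi>\<in>S. q ^ (length l - 1) * (1 / card S))"
      using \<open>0 \<le> q\<close> by (subst sum_ennreal[symmetric]) (auto simp: ennreal_mult[symmetric])
    then show "(\<Sum>\<pi>\<in>S. ennreal (q ^ (length l - 1)) * ennreal (1 / card S)) = ennreal (q ^ (length l - 1))"
      using cardS by simp
  qed
  also have "\<dots> = ennreal (\<Sum>l\<in>cycle_lists n. q ^ (length l - 1))"
    using \<open>0 \<le> q\<close> by (intro sum_ennreal) simp
  finally have "L.expectation W \<le> (\<Sum>l\<in>cycle_lists n. q ^ (length l - 1))"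
    using \<open>0 \<le> q\<close> \<open>\<And>w. 0 \<le> W w\<close> by (intro L.integral_le_of_nn_integral_le sum_nonneg) auto
  note bound_q = this
  have "L.expectation W \<le> 2 * (real n)\<^sup>2 * q"
  proof (cases "n * q \<le> 1 / 2")
    case True
    then show ?thesis using bound_q sum_cycle_lists_le[OF \<open>0 \<le> q\<close> True] by linarith
  next
    case False
    \<comment> \<open>Here \<open>2 * (n * q)\<close> exceeds 1, so the trivial bound
      \<open>n\<close> is already below the target.\<close>
    then have "real n * 1 \<le> n * (2 * (n * q))" by (intro mult_left_mono) auto
    then show ?thesis using bound_n by (simp add: power2_eq_square mult_ac)
  qed
  then show "LSS_risk d n \<sigma> P Q est \<le> 2 * (real n)\<^sup>2 * (16 * K * \<sigma> * exp \<beta>) ^ d"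
    by (simp add: risk q_def)
qed

section \<open>Choice of the absolute constant\<close>

theorem theorem1p7:
  shows "\<exists>b_LD::real. b_LD > 0 \<and>
    (\<forall>(d::nat) (n::nat) (\<sigma>::real) (N::(nat \<Rightarrow> real) \<Rightarrow> real) (R::real) (\<gamma>::real) (\<beta>::real) (KQ::real)
       (P::(nat \<Rightarrow> real) measure) (Q::(nat \<Rightarrow> real) measure) est.
       \<sigma> > 0 \<longrightarrow> n \<ge> 2 \<longrightarrow>
       LDS_assumptions d N R \<gamma> \<beta> KQ P Q \<longrightarrow>
       1 \<le> KQ * exp \<beta> \<longrightarrow>
       is_LSS d n est \<longrightarrow>
       (let K = b_LD * KQ\<^sup>2 * exp (2 * \<beta>)
        in LSS_risk d n \<sigma> P Q est \<le> min (3 * K ^ d * (real n)\<^sup>2 * \<sigma> ^ d) (real n)))"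
\<comment> \<open>The witness is the constant of \<open>LSS_risk_le\<close>, where 16 bounds
  \<open>8 * sqrt pi\<close>.\<close>
proof (intro exI[of _ 16] conjI allI impI)
  fix d n :: nat and \<sigma> R \<gamma> \<beta> KQ :: real and N and P Q :: "(nat \<Rightarrow> real) measure" and est
  assume \<sigma>: "0 < \<sigma>" and A: "LDS_assumptions d N R \<gamma> \<beta> KQ P Q"
    and K1: "1 \<le> KQ * exp \<beta>" and est: "is_LSS d n est"
  have "0 < KQ"
    using K1 by (smt (verit) exp_gt_zero mult_nonneg_nonpos2 mult.commute)
  let ?K = "16 * KQ\<^sup>2 * exp (2 * \<beta>)"
  \<comment> \<open>The normalisation of \<open>KQ\<close> lets \<open>KQ * exp \<beta>\<close> be
    replaced by its square, which is the form it has in \<open>K\<close>.\<close>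
  have "(16 * \<sigma> * (KQ * exp \<beta>)) * 1 \<le> (16 * \<sigma> * (KQ * exp \<beta>)) * (KQ * exp \<beta>)"
    using K1 \<sigma> \<open>0 < KQ\<close> by (intro mult_left_mono) auto
  moreover have "exp (2 * \<beta>) = exp \<beta> * exp \<beta>"
    by (simp only: mult_2 exp_add)
  ultimately have "16 * KQ * \<sigma> * exp \<beta> \<le> ?K * \<sigma>"
    by (simp only: power2_eq_square mult_ac mult_1_right)
  then have "(16 * KQ * \<sigma> * exp \<beta>) ^ d \<le> (?K * \<sigma>) ^ d"
    using \<sigma> \<open>0 < KQ\<close> by (intro power_mono) auto
  then have "2 * (real n)\<^sup>2 * (16 * KQ * \<sigma> * exp \<beta>) ^ d \<le> 3 * (real n)\<^sup>2 * (?K * \<sigma>) ^ d"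
    using \<sigma> \<open>0 < KQ\<close> by (intro mult_mono) auto
  then have "LSS_risk d n \<sigma> P Q est \<le> 3 * (real n)\<^sup>2 * (?K * \<sigma>) ^ d"
    using LSS_risk_le(2)[OF \<sigma> A \<open>0 < KQ\<close> est] by linarith
  also have "\<dots> = 3 * ?K ^ d * (real n)\<^sup>2 * \<sigma> ^ d"
    by (simp add: power_mult_distrib mult_ac)
  finally show "let K = 16 * KQ\<^sup>2 * exp (2 * \<beta>)
      in LSS_risk d n \<sigma> P Q est \<le> min (3 * K ^ d * (real n)\<^sup>2 * \<sigma> ^ d) (real n)"
    using LSS_risk_le(1)[OF \<sigma> A \<open>0 < KQ\<close> est] by (simp add: Let_def)
qed simp

end
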